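(* Let $k$ be a perfect field of characteristic $p>0$, $m\ge2$ with $p\nmid m$, $f\in k[x]$ squarefree of degree $d\ge3$, and $X\colon y^m=f(x)$ the corresponding superelliptic curve with function field $K$. For $1\le j\le m_1:=m-\lfloor m/d\rfloor-1$ let $\vec\omega_j=\{\omega_{ij}: 1\le i\le d_j\}$ where $d_j=d-\lfloor dj/m\rfloor-1$. Let $1\le j,\ell\le m_1$ with $\ell\equiv jp\pmod m$. Then the Cartier operator maps the $k$-span of $\vec\omega_\ell$ into the $k$-span of $\vec\omega_j$, and this action is given by the matrix $B^{j\ell}=[(b^{j\ell}_{ik})^{1/p}]$, namely $\mathcal{C}(\omega_{k\ell})=\sum_{i=1}^{d_j}(b^{j\ell}_{ik})^{1/p}\omega_{ij}$ for $1\le k\le d_\ell$. In particular, when $p\equiv1\pmod m$, the Cartier operator maps each span of $\vec\omega_j$ into itself.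
   Context: The superelliptic curve $X$ is the smooth projective curve with function field $K=k(x)[y]/(y^m-f(x))$. The Cartier operator $\mathcal{C}\colon\Omega_K\to\Omega_K$ is defined by writing any differential uniquely as $(z_0^p+z_1^px+\cdots+z_{p-1}^px^{p-1})dx$ with $z_i\in K$ and setting $\mathcal{C}$ of it equal to $z_{p-1}dx$. Put $F=y^m-f(x)$, $F_y=my^{m-1}$, $\omega_{ij}=x^{i-1}y^{j-1}dx/F_y$; the $\omega_{ij}$ with $i,j\ge1$ and $mi+dj<md$ form a basis of the regular differentials. For $n\ge0$ and $a\in\mathbf{Z}$ let $f^n_a$ denote the coefficient of $x^a$ in $f(x)^n$ (zero if $a<0$ or $a>nd$). Set $n_j=p-1-\lfloor jp/m\rfloor$ and, for $1\le i\le d_j$, $1\le k\le d_\ell$, $b^{j\ell}_{ik}=f^{n_j}_{ip-k}$ if $(jp-\ell)/m\in\mathbf{Z}_{\ge0}$ and $b^{j\ell}_{ik}=0$ otherwise. *)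

theory Defs
  imports
    "HOL-Computational_Algebra.Computational_Algebra"
    "HOL-Library.Poly_Mapping"
    "HOL-Number_Theory.Cong"
begin

section \<open>Kaehler differentials\<close>

text \<open>
  The \<open>R\<close>-module of Kaehler differentials over a set of constants \<open>C\<close> is the free \<open>R\<close>-module on
  symbols \<open>d a\<close> (\<open>a\<close> in \<open>R\<close>), here \<open>Poly_Mapping.single a 1\<close>, modulo the submodule below.
  Additivity and the Leibniz rule together with \<open>d c = 0\<close> for \<open>c\<close> in a subring \<open>C\<close> give
  \<open>C\<close>-linearity of \<open>d\<close>.
\<close>

abbreviation fscale :: "'r::comm_ring_1 \<Rightarrow> ('b \<Rightarrow>\<^sub>0 'r) \<Rightarrow> ('b \<Rightarrow>\<^sub>0 'r)" where
  "fscale c \<equiv> Poly_Mapping.map ((*) c)"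

lemma lookup_fscale [simp]: "Poly_Mapping.lookup (fscale c v) a = c * Poly_Mapping.lookup v a"
  by (simp add: Poly_Mapping.map.rep_eq when_def)

global_interpretation free_module: module "fscale :: 'r::comm_ring_1 \<Rightarrow> ('b \<Rightarrow>\<^sub>0 'r) \<Rightarrow> ('b \<Rightarrow>\<^sub>0 'r)"
  by standard (rule poly_mapping_eqI, simp add: lookup_add algebra_simps)+

definition kaehler_generators :: "'r::comm_ring_1 set \<Rightarrow> ('r \<Rightarrow>\<^sub>0 'r) set" where
  "kaehler_generators C =
     {Poly_Mapping.single (a + b) 1 - Poly_Mapping.single a 1 - Poly_Mapping.single b 1 | a b. True}
   \<union> {Poly_Mapping.single (a * b) 1 - fscale a (Poly_Mapping.single b 1)
        - fscale b (Poly_Mapping.single a 1) | a b. True}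
   \<union> {Poly_Mapping.single c 1 | c. c \<in> C}"

definition kaehler_relations :: "'r::comm_ring_1 set \<Rightarrow> ('r \<Rightarrow>\<^sub>0 'r) set" where
  "kaehler_relations C = module.span fscale (kaehler_generators C)"

text \<open>
  The type \<open>'r kaehler\<close> has no constants besides those forced by the Leibniz rule. For a field
  extension \<open>K\<close> of a perfect field \<open>k\<close> of characteristic \<open>p\<close> this is the module of differentials
  of \<open>K\<close> over \<open>k\<close>: the two submodules of relations are equal, see \<open>kaehler_relations_perfect\<close>.
\<close>

quotient_type (overloaded) 'r kaehler = "'r::comm_ring_1 \<Rightarrow>\<^sub>0 'r" /
  "\<lambda>u v. u - v \<in> kaehler_relations {}"
proof (rule equivpI)
  show "reflp (\<lambda>u v::'r \<Rightarrow>\<^sub>0 'r. u - v \<in> kaehler_relations {})"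
    by (auto simp: reflp_def kaehler_relations_def free_module.span_zero)
  show "symp (\<lambda>u v::'r \<Rightarrow>\<^sub>0 'r. u - v \<in> kaehler_relations {})"
  proof (rule sympI)
    fix u v :: "'r \<Rightarrow>\<^sub>0 'r" assume "u - v \<in> kaehler_relations {}"
    from free_module.span_neg[OF this[unfolded kaehler_relations_def]]
    show "v - u \<in> kaehler_relations {}" by (simp add: kaehler_relations_def)
  qed
  show "transp (\<lambda>u v::'r \<Rightarrow>\<^sub>0 'r. u - v \<in> kaehler_relations {})"
  proof (rule transpI)
    fix u v w :: "'r \<Rightarrow>\<^sub>0 'r"
    assume "u - v \<in> kaehler_relations {}" "v - w \<in> kaehler_relations {}"
    from free_module.span_add[OF this[unfolded kaehler_relations_def]]
    show "u - w \<in> kaehler_relations {}" by (simp add: kaehler_relations_def)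
  qed
qed

instantiation kaehler :: (comm_ring_1) ab_group_add
begin

lift_definition zero_kaehler :: "'a kaehler" is 0 .

lift_definition plus_kaehler :: "'a kaehler \<Rightarrow> 'a kaehler \<Rightarrow> 'a kaehler" is "(+)"
proof -
  fix u u' v v' :: "'a \<Rightarrow>\<^sub>0 'a"
  assume "u - u' \<in> kaehler_relations {}" "v - v' \<in> kaehler_relations {}"
  from free_module.span_add[OF this[unfolded kaehler_relations_def]]
  show "u + v - (u' + v') \<in> kaehler_relations {}" by (simp add: kaehler_relations_def algebra_simps)
qed

lift_definition uminus_kaehler :: "'a kaehler \<Rightarrow> 'a kaehler" is uminus
proof -
  fix u u' :: "'a \<Rightarrow>\<^sub>0 'a"
  assume "u - u' \<in> kaehler_relations {}"
  from free_module.span_neg[OF this[unfolded kaehler_relations_def]]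
  show "- u - - u' \<in> kaehler_relations {}" by (simp add: kaehler_relations_def algebra_simps)
qed

lift_definition minus_kaehler :: "'a kaehler \<Rightarrow> 'a kaehler \<Rightarrow> 'a kaehler" is "(-)"
proof -
  fix u u' v v' :: "'a \<Rightarrow>\<^sub>0 'a"
  assume "u - u' \<in> kaehler_relations {}" "v - v' \<in> kaehler_relations {}"
  from free_module.span_diff[OF this[unfolded kaehler_relations_def]]
  show "u - v - (u' - v') \<in> kaehler_relations {}" by (simp add: kaehler_relations_def algebra_simps)
qed

instance
  by standard (transfer; simp add: kaehler_relations_def free_module.span_zero algebra_simps)+

end

lift_definition kscale :: "'r::comm_ring_1 \<Rightarrow> 'r kaehler \<Rightarrow> 'r kaehler" is fscale
proof -
  fix c :: 'r and u u' :: "'r \<Rightarrow>\<^sub>0 'r"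
  assume "u - u' \<in> kaehler_relations {}"
  from free_module.span_scale[OF this[unfolded kaehler_relations_def], of c]
  show "fscale c u - fscale c u' \<in> kaehler_relations {}"
    by (simp add: kaehler_relations_def free_module.scale_right_diff_distrib)
qed

lift_definition kd :: "'r::comm_ring_1 \<Rightarrow> 'r kaehler" is "\<lambda>a. Poly_Mapping.single a 1" .

lemma module_kscale: "module (kscale :: 'r::comm_ring_1 \<Rightarrow> 'r kaehler \<Rightarrow> 'r kaehler)"
  by standard (transfer; simp add: kaehler_relations_def free_module.span_zero
      free_module.scale_right_distrib free_module.scale_left_distrib)+

lemma kd_add: "kd (a + b) = kd a + kd b"
  by transfer (force simp: kaehler_relations_def kaehler_generators_def diff_diff_eq
      intro!: free_module.span_base)

lemma kd_mult: "kd (a * b) = kscale a (kd b) + kscale b (kd a)"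
  by transfer (force simp: kaehler_relations_def kaehler_generators_def diff_diff_eq
      intro!: free_module.span_base)

lemma kd_power: "kd (a ^ Suc n) = kscale (of_nat (Suc n) * a ^ n) (kd a)"
proof (induction n)
  case 0
  show ?case by (simp add: module.scale_one[OF module_kscale])
next
  case (Suc n)
  have "kd (a ^ Suc (Suc n)) = kscale a (kd (a ^ Suc n)) + kscale (a ^ Suc n) (kd a)"
    by (simp only: power_Suc[of a "Suc n"] kd_mult)
  also have "\<dots> = kscale (of_nat (Suc (Suc n)) * a ^ Suc n) (kd a)"
    unfolding Suc.IH module.scale_scale[OF module_kscale]
      module.scale_left_distrib[OF module_kscale, symmetric]
    by (rule arg_cong[where f = "\<lambda>c. kscale c (kd a)"]) (simp add: algebra_simps)
  finally show ?case .
qed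

lemma kd_power_CHAR:
  assumes "CHAR('r) = p" "p > 0"
  shows "kd ((a :: 'r::comm_ring_1) ^ p) = 0"
  using kd_power[of a "p - 1"] assms of_nat_CHAR[where 'a = 'r]
  by (simp add: module.scale_zero_left[OF module_kscale])

lemma kaehler_relations_perfect:
  fixes C :: "'r::comm_ring_1 set"
  assumes "CHAR('r) = p" "p > 0" "C \<subseteq> (\<lambda>a. a ^ p) ` C"
  shows "kaehler_relations C = kaehler_relations {}"
proof
  have "Poly_Mapping.single c 1 \<in> kaehler_relations {}" if "c \<in> C" for c
  proof -
    from that assms obtain a where "c = a ^ p" by blast
    hence "kd c = 0" using kd_power_CHAR[OF assms(1,2)] by simp
    thus ?thesis by transfer simp
  qed
  moreover have "kaehler_generators {} \<subseteq> kaehler_relations {}"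
    by (auto simp: kaehler_relations_def intro: free_module.span_base)
  ultimately have "kaehler_generators C \<subseteq> kaehler_relations {}"
    unfolding kaehler_generators_def by blast
  thus "kaehler_relations C \<subseteq> kaehler_relations {}"
    unfolding kaehler_relations_def by (rule free_module.span_minimal) (rule free_module.subspace_span)
  show "kaehler_relations {} \<subseteq> kaehler_relations C"
    unfolding kaehler_relations_def
    by (rule free_module.span_mono) (auto simp: kaehler_generators_def)
qed

section \<open>The Cartier operator\<close>

text \<open>
  The description is definite when \<open>1, x, \<dots>, x^(p-1)\<close> is a basis of \<open>K\<close> over its subfield of
  \<open>p\<close>-th powers and \<open>d x\<close> is a basis of the differentials; otherwise the value is unspecified.
\<close>

definition cartier :: "nat \<Rightarrow> 'r::comm_ring_1 \<Rightarrow> 'r kaehler \<Rightarrow> 'r kaehler" where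
  "cartier p x \<omega> = (THE \<eta>. \<exists>z :: nat \<Rightarrow> 'r.
     \<omega> = kscale (\<Sum>i<p. z i ^ p * x ^ i) (kd x) \<and> \<eta> = kscale (z (p - 1)) (kd x))"

section \<open>The function field of a superelliptic curve\<close>

text \<open>
  \<open>k(x)\<close> is the type \<open>'a poly fract\<close>, and \<open>k(x)[y]\<close> is \<open>'a poly fract poly\<close>. As the ideal generated
  by \<open>y^m - f(x)\<close> depends on terms, the quotient is not a type by itself; a field type \<open>'K\<close> is
  exhibited as the quotient by a surjective ring homomorphism \<open>\<pi>\<close> whose kernel is this ideal.
\<close>

definition quotient_map :: "('r::comm_ring_1 \<Rightarrow> 's::comm_ring_1) \<Rightarrow> 'r \<Rightarrow> bool" where
  "quotient_map \<pi> r \<longleftrightarrow>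
     \<pi> 1 = 1 \<and> (\<forall>a b. \<pi> (a + b) = \<pi> a + \<pi> b) \<and> (\<forall>a b. \<pi> (a * b) = \<pi> a * \<pi> b) \<and>
     surj \<pi> \<and> (\<forall>a. \<pi> a = 0 \<longleftrightarrow> r dvd a)"

definition superelliptic_function_field ::
  "nat \<Rightarrow> 'a::field poly \<Rightarrow> ('a poly fract poly \<Rightarrow> 'K::field) \<Rightarrow> bool" where
  "superelliptic_function_field m f \<pi> \<longleftrightarrow> quotient_map \<pi> (monom 1 m - [:to_fract f:])"

definition const_of :: "('a::field poly fract poly \<Rightarrow> 'K) \<Rightarrow> 'a \<Rightarrow> 'K" where
  "const_of \<pi> c = \<pi> [:to_fract [:c:]:]"

definition gen_x :: "('a::field poly fract poly \<Rightarrow> 'K) \<Rightarrow> 'K" where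
  "gen_x \<pi> = \<pi> [:to_fract [:0, 1:]:]"

definition gen_y :: "('a::field poly fract poly \<Rightarrow> 'K) \<Rightarrow> 'K" where
  "gen_y \<pi> = \<pi> [:0, 1:]"

text \<open>The denominator is the partial derivative of \<open>y^m - f(x)\<close> with respect to \<open>y\<close>.\<close>

definition omega ::
  "nat \<Rightarrow> ('a::field poly fract poly \<Rightarrow> 'K::field) \<Rightarrow> nat \<Rightarrow> nat \<Rightarrow> 'K kaehler" where
  "omega m \<pi> i j = kscale (gen_x \<pi> ^ (i - 1) * gen_y \<pi> ^ (j - 1) / (of_nat m * gen_y \<pi> ^ (m - 1)))
     (kd (gen_x \<pi>))"

definition m1 :: "nat \<Rightarrow> nat \<Rightarrow> nat" where
  "m1 m d = m - m div d - 1"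

definition dj :: "nat \<Rightarrow> nat \<Rightarrow> nat \<Rightarrow> nat" where
  "dj m d j = d - (d * j) div m - 1"

definition omega_span ::
  "nat \<Rightarrow> nat \<Rightarrow> ('a::field poly fract poly \<Rightarrow> 'K::field) \<Rightarrow> nat \<Rightarrow> 'K kaehler set" where
  "omega_span m d \<pi> j =
     module.span (\<lambda>c. kscale (const_of \<pi> c)) {omega m \<pi> i j | i. 1 \<le> i \<and> i \<le> dj m d j}"

definition coeff_int :: "'a::zero poly \<Rightarrow> int \<Rightarrow> 'a" where
  "coeff_int g a = (if a < 0 then 0 else coeff g (nat a))"

definition nj :: "nat \<Rightarrow> nat \<Rightarrow> nat \<Rightarrow> nat" where
  "nj p m j = p - 1 - (j * p) div m"

definition b_entry :: "nat \<Rightarrow> nat \<Rightarrow> 'a::field poly \<Rightarrow> nat \<Rightarrow> nat \<Rightarrow> nat \<Rightarrow> nat \<Rightarrow> 'a" where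
  "b_entry p m f j l i k =
     (if (of_int (int j * int p - int l) / of_nat m :: rat) \<in> \<nat>
      then coeff_int (f ^ nj p m j) (int i * int p - int k) else 0)"

text \<open>The inverse of Frobenius, which is bijective on a perfect field of characteristic \<open>p\<close>.\<close>

definition frobenius_root :: "nat \<Rightarrow> 'a::field \<Rightarrow> 'a" where
  "frobenius_root p = inv (\<lambda>c. c ^ p)"

definition B_matrix :: "nat \<Rightarrow> nat \<Rightarrow> 'a::field poly \<Rightarrow> nat \<Rightarrow> nat \<Rightarrow> nat \<Rightarrow> nat \<Rightarrow> 'a" where
  "B_matrix p m f j l i k = frobenius_root p (b_entry p m f j l i k)"

end

theory Submission
  imports Defs
begin

text \<open>
  Write \<open>j p = m t + l\<close> and \<open>n = p - 1 - t\<close>. Since \<open>y^m = f\<close> one has \<open>y^(l - m) = (y^j / f)^p f^n\<close>, so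
  \<open>\<omega>\<^sub>k\<^sub>l\<close> is a \<open>p\<close>-th power times the polynomial differential \<open>x^(k - 1) f^n dx\<close>, and the Cartier
  operator extracts the coefficients of \<open>x^(i p - 1)\<close> from \<open>x^(k - 1) f^n\<close>. A degree estimate
  shows that those with \<open>i > d\<^sub>j\<close> vanish.

  The Cartier operator is well defined at these differentials because \<open>K\<close> carries a derivation
  \<open>D\<close> with \<open>D x = 1\<close>: it factors through the differentials, so \<open>dx\<close> has no torsion, and it kills
  \<open>p\<close>-th powers, so applying it \<open>p - 1\<close> times to \<open>\<Sum> z\<^sub>i^p x^i\<close> leaves \<open>(p - 1)! z^p\<close> with \<open>z\<close> the last coefficient.
\<close>

section \<open>Derivations\<close>

locale derivation =
  fixes D :: "'r::comm_ring_1 \<Rightarrow> 'r"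
  assumes add: "D (a + b) = D a + D b"
    and mult: "D (a * b) = a * D b + b * D a"
begin

lemma zero [simp]: "D 0 = 0"
  using add[of 0 0] by simp

lemma one [simp]: "D 1 = 0"
  using mult[of 1 1] by simp

lemma uminus: "D (- a) = - D a"
  using add[of a "- a"] by (simp add: eq_neg_iff_add_eq_0 add.commute)

lemma diff: "D (a - b) = D a - D b"
  using add[of a "- b"] by (simp add: uminus)

lemma sum: "D (\<Sum>i\<in>A. g i) = (\<Sum>i\<in>A. D (g i))"
  by (induction A rule: infinite_finite_induct) (simp_all add: add)

lemma of_power_Suc: "D (a ^ Suc n) = of_nat (Suc n) * a ^ n * D a"
proof (induction n)
  case (Suc n)
  have "D (a ^ Suc (Suc n)) = a * D (a ^ Suc n) + a ^ Suc n * D a"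
    by (simp only: power_Suc[of a "Suc n"] mult)
  thus ?case unfolding Suc.IH by (simp add: algebra_simps)
qed simp

lemma power_CHAR:
  assumes "CHAR('r) = p" "p > 0"
  shows "D (a ^ p) = 0"
  using of_power_Suc[of a "p - 1"] assms of_nat_CHAR[where 'a = 'r] by simp

end

text \<open>Universal property: a derivation extends to a linear functional vanishing on the relations.\<close>

lemma kscale_kd_eqD:
  assumes "derivation D" "kscale a (kd b) = kscale c (kd b)"
  shows "a * D b = c * D b"
proof -
  interpret derivation D by fact
  define \<phi> where "\<phi> v = (\<Sum>s\<in>Poly_Mapping.keys v. Poly_Mapping.lookup v s * D s)"
    for v :: "'a \<Rightarrow>\<^sub>0 'a"
  \<comment> \<open>The support in the defining sum changes under addition and scaling; enlarging it
    to a common finite set makes linearity termwise.\<close>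
  have \<phi>_superset: "\<phi> v = (\<Sum>s\<in>S. Poly_Mapping.lookup v s * D s)"
    if "finite S" "Poly_Mapping.keys v \<subseteq> S" for v S
    unfolding \<phi>_def using that by (intro sum.mono_neutral_left) (auto simp: in_keys_iff)
  have \<phi>_add: "\<phi> (u + v) = \<phi> u + \<phi> v" for u v
  proof -
    define S where "S = Poly_Mapping.keys u \<union> Poly_Mapping.keys v"
    have S: "finite S" "Poly_Mapping.keys u \<subseteq> S" "Poly_Mapping.keys v \<subseteq> S"
      "Poly_Mapping.keys (u + v) \<subseteq> S"
      using keys_add[of u v] by (auto simp: S_def)
    show ?thesis
      by (simp add: \<phi>_superset[OF S(1)] S lookup_add algebra_simps sum.distrib)
  qed
  have \<phi>_scale: "\<phi> (fscale r v) = r * \<phi> v" for r v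
  proof -
    have "Poly_Mapping.keys (fscale r v) \<subseteq> Poly_Mapping.keys v"
      by (auto simp: in_keys_iff)
    from \<phi>_superset[OF _ this] \<phi>_def[of v] show ?thesis
      by (simp add: sum_distrib_left mult.assoc)
  qed
  have \<phi>_diff: "\<phi> (u - v) = \<phi> u - \<phi> v" for u v
    using \<phi>_add[of "u - v" v] by simp
  have \<phi>_single: "\<phi> (Poly_Mapping.single s r) = r * D s" for s r
    by (simp add: \<phi>_def lookup_single)
  have "\<phi> v = 0" if "v \<in> kaehler_relations {}" for v
    using that unfolding kaehler_relations_def
  proof (induction rule: free_module.span_induct_alt)
    case base
    show ?case by (simp add: \<phi>_def)
  next
    case (step r g v)
    hence "\<phi> g = 0"
      by (auto simp: kaehler_generators_def \<phi>_diff \<phi>_scale \<phi>_single add mult)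
    with step show ?case by (simp add: \<phi>_add \<phi>_scale)
  qed
  moreover have "fscale a (Poly_Mapping.single b 1) - fscale c (Poly_Mapping.single b 1)
      \<in> kaehler_relations {}"
    using assms(2) by transfer
  ultimately have "\<phi> (fscale a (Poly_Mapping.single b 1) - fscale c (Poly_Mapping.single b 1)) = 0"
    by blast
  thus ?thesis
    by (simp only: \<phi>_diff \<phi>_scale \<phi>_single) simp
qed

section \<open>Derivations on fraction fields, polynomial rings and quotients\<close>

text \<open>The quotient rule dictates the value. It does not depend on the representing fraction,
  so an arbitrary choice by \<open>SOME\<close> is harmless.\<close>

lemma derivation_extends_to_fract:
  fixes D :: "'r::idom \<Rightarrow> 'r"
  assumes "derivation D"
  obtains E where "derivation E" "\<And>a. E (to_fract a) = to_fract (D a)"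
proof -
  interpret derivation D by fact
  define E where "E q = (SOME r. \<exists>a b. b \<noteq> 0 \<and> q = to_fract a / to_fract b \<and>
    r = to_fract (b * D a - a * D b) / to_fract (b * b))" for q
  have quot: "\<exists>a b. b \<noteq> 0 \<and> q = to_fract a / to_fract b" for q :: "'r fract"
    by (cases q rule: Fract_cases) (metis Fract_conv_to_fract)
  have E: "E (to_fract a / to_fract b) = to_fract (b * D a - a * D b) / to_fract (b * b)"
    if "b \<noteq> 0" for a b
  proof -
    have "to_fract (b' * D a' - a' * D b') / to_fract (b' * b')
        = to_fract (b * D a - a * D b) / to_fract (b * b)"
      if "b' \<noteq> 0" "to_fract a / to_fract b = to_fract a' / to_fract b'" for a' b'
    proof -
      have "to_fract (a * b') = to_fract (a' * b)"
        using that \<open>b \<noteq> 0\<close> by (simp add: frac_eq_eq)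
      hence eq: "a * b' = a' * b" by (simp only: to_fract_eq_iff)
      hence "D (a * b') = D (a' * b)" by simp
      hence deq: "a * D b' + b' * D a = a' * D b + b * D a'" by (simp only: mult)
      \<comment> \<open>Cross-multiplied, the two values differ by a combination of
        \<open>a * b' - a' * b\<close> and its derivative, both of which vanish.\<close>
      have "(b' * D a' - a' * D b') * (b * b) - (b * D a - a * D b) * (b' * b') =
          b * b' * ((a' * D b + b * D a') - (a * D b' + b' * D a))
          + (b * D b' + b' * D b) * (a * b' - a' * b)"
        by (simp add: algebra_simps)
      also have "\<dots> = 0" by (simp only: eq deq) simp
      finally have "(b' * D a' - a' * D b') * (b * b) = (b * D a - a * D b) * (b' * b')" by simp
      hence "to_fract (b' * D a' - a' * D b') * to_fract (b * b) =
          to_fract (b * D a - a * D b) * to_fract (b' * b')"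
        by (simp only: to_fract_mult[symmetric])
      moreover have "to_fract (b' * b') \<noteq> 0" "to_fract (b * b) \<noteq> 0"
        using that \<open>b \<noteq> 0\<close> by simp_all
      ultimately show ?thesis by (metis frac_eq_eq)
    qed
    note unique = this
    show ?thesis unfolding E_def
    proof (rule some_equality)
      show "\<exists>a' b'. b' \<noteq> 0 \<and> to_fract a / to_fract b = to_fract a' / to_fract b' \<and>
          to_fract (b * D a - a * D b) / to_fract (b * b) =
          to_fract (b' * D a' - a' * D b') / to_fract (b' * b')"
        using that by (intro exI[of _ a] exI[of _ b] conjI refl)
    qed (elim exE conjE, hypsubst, rule unique)
  qed
  show ?thesis
  proof
    show "derivation E"
    proof
      fix q r :: "'r fract"
      obtain a b where ab: "b \<noteq> 0" "q = to_fract a / to_fract b" using quot[of q] by (elim exE conjE)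
      obtain c e where ce: "e \<noteq> 0" "r = to_fract c / to_fract e" using quot[of r] by (elim exE conjE)
      have nz: "to_fract b \<noteq> 0" "to_fract e \<noteq> 0" "b * e \<noteq> 0" using ab ce by simp_all
      have "q + r = to_fract (a * e + c * b) / to_fract (b * e)"
        unfolding ab(2) ce(2) to_fract_add to_fract_mult using nz by (simp add: add_frac_eq)
      hence "E (q + r) = to_fract (b * e * D (a * e + c * b) - (a * e + c * b) * D (b * e))
          / to_fract (b * e * (b * e))"
        using E[OF nz(3)] by (simp only:)
      also have "\<dots> = E q + E r"
        unfolding ab(2) ce(2) E[OF ab(1)] E[OF ce(1)] add mult to_fract_mult to_fract_diff
          to_fract_add
        using nz(1,2) by (simp add: divide_simps) (simp add: algebra_simps)
      finally show "E (q + r) = E q + E r" .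
      have "q * r = to_fract (a * c) / to_fract (b * e)"
        by (simp only: ab(2) ce(2) to_fract_mult times_divide_times_eq)
      hence "E (q * r) = to_fract (b * e * D (a * c) - (a * c) * D (b * e))
          / to_fract (b * e * (b * e))"
        using E[OF nz(3)] by (simp only:)
      also have "\<dots> = q * E r + r * E q"
        unfolding ab(2) ce(2) E[OF ab(1)] E[OF ce(1)] add mult to_fract_mult to_fract_diff
          to_fract_add
        using nz(1,2) by (simp add: divide_simps) (simp add: algebra_simps)
      finally show "E (q * r) = q * E r + r * E q" .
    qed
    show "E (to_fract a) = to_fract (D a)" for a
      using E[of 1 a] by simp
  qed
qed

text \<open>A sum of two derivations. The first acts on coefficients and kills the indeterminate, so
  \<open>u\<close> is the image of the indeterminate and can be prescribed freely.\<close>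

lemma derivation_extends_to_poly:
  assumes "derivation D"
  shows "derivation (\<lambda>g. map_poly D g + u * pderiv g)"
proof -
  interpret derivation D by fact
  have "map_poly D (g * h) = g * map_poly D h + h * map_poly D g" for g h
  proof (rule poly_eqI)
    fix n
    have "coeff (map_poly D (g * h)) n =
        (\<Sum>i\<le>n. coeff g i * D (coeff h (n - i))) + (\<Sum>i\<le>n. coeff h (n - i) * D (coeff g i))"
      by (simp add: coeff_map_poly coeff_mult sum mult sum.distrib)
    also have "(\<Sum>i\<le>n. coeff h (n - i) * D (coeff g i)) = coeff (map_poly D g * h) n"
      unfolding coeff_mult by (rule sum.cong) (simp_all add: coeff_map_poly mult.commute)
    finally show "coeff (map_poly D (g * h)) n = coeff (g * map_poly D h + h * map_poly D g) n"
      by (simp only: coeff_add coeff_mult[of g] coeff_map_poly zero mult.commute[of h "map_poly D g"])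
  qed
  moreover have "map_poly D (g + h) = map_poly D g + map_poly D h" for g h
    by (rule poly_eqI) (simp add: coeff_map_poly add)
  ultimately show ?thesis
    by unfold_locales (simp_all add: pderiv_mult pderiv_add algebra_simps)
qed

text \<open>By the Leibniz rule \<open>D (r * c) = r * D c + c * D r\<close>, so divisibility of
  \<open>D r\<close> by \<open>r\<close> makes the whole ideal stable. The value is then computed on
  any preimage.\<close>

lemma derivation_descends_to_quotient:
  assumes "derivation D" "quotient_map \<pi> r" "r dvd D r"
  obtains E where "derivation E" "\<And>a. E (\<pi> a) = \<pi> (D a)"
proof -
  interpret derivation D by fact
  have \<pi>: "\<pi> (a + b) = \<pi> a + \<pi> b" "\<pi> (a * b) = \<pi> a * \<pi> b" "surj \<pi>" "\<pi> a = 0 \<longleftrightarrow> r dvd a" for a b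
    using assms(2) by (auto simp: quotient_map_def)
  have \<pi>_diff: "\<pi> (a - b) = \<pi> a - \<pi> b" for a b
    using \<pi>(1)[of "a - b" b] by simp
  have E: "\<pi> (D (inv \<pi> (\<pi> a))) = \<pi> (D a)" for a
  proof -
    have "\<pi> (inv \<pi> (\<pi> a) - a) = 0"
      by (simp add: \<pi>_diff surj_f_inv_f \<pi>(3))
    then obtain c where "inv \<pi> (\<pi> a) - a = r * c" using \<pi>(4) by blast
    hence "D (inv \<pi> (\<pi> a) - a) = r * D c + c * D r" by (simp only: mult)
    hence "r dvd D (inv \<pi> (\<pi> a)) - D a" using assms(3) by (simp add: diff)
    thus ?thesis using \<pi>(4) \<pi>_diff by (metis eq_iff_diff_eq_0)
  qed
  show ?thesis
  proof
    show "derivation (\<lambda>s. \<pi> (D (inv \<pi> s)))"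
    proof
      fix s t
      obtain a b where "s = \<pi> a" "t = \<pi> b" using \<pi>(3) by (metis surj_f_inv_f)
      thus "\<pi> (D (inv \<pi> (s + t))) = \<pi> (D (inv \<pi> s)) + \<pi> (D (inv \<pi> t))"
        and "\<pi> (D (inv \<pi> (s * t))) = s * \<pi> (D (inv \<pi> t)) + t * \<pi> (D (inv \<pi> s))"
        by (simp_all only: \<pi>(1,2)[symmetric] E add mult)
    qed
  qed (rule E)
qed

section \<open>The Cartier operator as a semilinear relation\<close>

text \<open>Each application of \<open>D\<close> lowers the degree in \<open>x\<close> by one and
  multiplies the top coefficient by the old degree. The factorial stays in the conclusion because
  the ring need not allow division.\<close>

lemma (in derivation) constant_coeffs_top:
  assumes "D x = 1" "\<And>i. D (c i) = 0" "(\<Sum>i\<le>n. c i * x ^ i) = 0"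
  shows "of_nat (fact n) * c n = 0"
  using assms(2,3)
proof (induction n arbitrary: c)
  case (Suc n)
  have "0 = D (\<Sum>i\<le>Suc n. c i * x ^ i)" by (simp only: Suc.prems zero)
  also have "\<dots> = (\<Sum>i\<le>n. of_nat (Suc i) * c (Suc i) * x ^ i)"
    unfolding sum.atMost_Suc_shift add sum
    by (simp add: mult Suc.prems of_power_Suc assms(1) algebra_simps del: power_Suc)
  finally have *: "(\<Sum>i\<le>n. of_nat (Suc i) * c (Suc i) * x ^ i) = 0" by simp
  \<comment> \<open>The new coefficients must again be killed by \<open>D\<close> for the induction
    hypothesis to apply.\<close>
  have "D (of_nat i) = 0" for i by (induction i) (simp_all add: add)
  hence "D (of_nat (Suc i) * c (Suc i)) = 0" for i
    by (simp only: mult Suc.prems(1)) simp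
  from Suc.IH[OF this *] show ?case
    by (simp add: algebra_simps)
qed simp

text \<open>The condition inside the definite description of \<open>cartier\<close>. As a relation
  it can be added and scaled before uniqueness is known.\<close>

definition cartier_rel :: "nat \<Rightarrow> 'r::comm_ring_1 \<Rightarrow> 'r kaehler \<Rightarrow> 'r kaehler \<Rightarrow> bool" where
  "cartier_rel p x \<omega> \<eta> \<longleftrightarrow> (\<exists>z :: nat \<Rightarrow> 'r.
     \<omega> = kscale (\<Sum>i<p. z i ^ p * x ^ i) (kd x) \<and> \<eta> = kscale (z (p - 1)) (kd x))"

text \<open>Uniqueness: \<open>D x = 1\<close> lets \<open>kscale_kd_eqD\<close> cancel
  \<open>kd x\<close>, then \<open>constant_coeffs_top\<close> compares the last coefficients, and
  Frobenius is injective on a domain.\<close>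

lemma cartier_eqI:
  fixes x :: "'r::idom"
  assumes "derivation D" "D x = 1" "CHAR('r) = p" "p > 0" "cartier_rel p x \<omega> \<eta>"
  shows "cartier p x \<omega> = \<eta>"
  unfolding cartier_def cartier_rel_def[symmetric]
proof (rule the_equality)
  interpret derivation D by fact
  have prime: "prime p" using assms prime_CHAR_semidom[where 'a = 'r] by simp
  fix \<eta>' assume "cartier_rel p x \<omega> \<eta>'"
  with assms(5) obtain z w where
    z: "\<omega> = kscale (\<Sum>i<p. z i ^ p * x ^ i) (kd x)" "\<eta> = kscale (z (p - 1)) (kd x)" and
    w: "\<omega> = kscale (\<Sum>i<p. w i ^ p * x ^ i) (kd x)" "\<eta>' = kscale (w (p - 1)) (kd x)"
    unfolding cartier_rel_def by (elim exE conjE)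
  have "(\<Sum>i<p. z i ^ p * x ^ i) * D x = (\<Sum>i<p. w i ^ p * x ^ i) * D x"
    using z(1) w(1) by (intro kscale_kd_eqD[OF assms(1)]) (rule trans[OF sym])
  hence "(\<Sum>i<p. z i ^ p * x ^ i) = (\<Sum>i<p. w i ^ p * x ^ i)"
    by (simp only: assms(2) mult_1_right)
  hence "(\<Sum>i<p. (z i ^ p - w i ^ p) * x ^ i) = 0"
    by (simp add: algebra_simps sum_subtractf)
  hence "(\<Sum>i\<le>p - 1. (z i ^ p - w i ^ p) * x ^ i) = 0"
    using assms(4) by (simp flip: lessThan_Suc_atMost)
  hence "of_nat (fact (p - 1)) * (z (p - 1) ^ p - w (p - 1) ^ p) = 0"
    using constant_coeffs_top[OF assms(2), of "\<lambda>i. z i ^ p - w i ^ p"] power_CHAR[OF assms(3,4)]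
    by (simp add: diff)
  moreover have "of_nat (fact (p - 1)) \<noteq> (0 :: 'r)"
    unfolding of_nat_eq_0_iff_char_dvd assms(3) prime_dvd_fact_iff[OF prime] using assms(4) by simp
  ultimately have eq: "z (p - 1) ^ p = w (p - 1) ^ p"
    by (simp only: mult_eq_0_iff simp_thms eq_iff_diff_eq_0[symmetric])
  \<comment> \<open>Additivity of Frobenius is applied to the sum (z - w) + w, which avoids
    discussing the sign of (-w)^p.\<close>
  have "z (p - 1) ^ p = (z (p - 1) - w (p - 1)) ^ p + w (p - 1) ^ p"
    using freshmans_dream[where x = "z (p - 1) - w (p - 1)" and y = "w (p - 1)" and n = p] prime
    unfolding assms(3) by (simp only: simp_thms diff_add_cancel)
  hence "(z (p - 1) - w (p - 1)) ^ p = 0"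
    unfolding eq by (simp only: add_cancel_left_left eq_commute[of "w (p - 1) ^ p"])
  hence "z (p - 1) = w (p - 1)" by (simp only: power_eq_0_iff right_minus_eq)
  thus "\<eta>' = \<eta>" by (simp only: z(2) w(2))
qed fact

section \<open>Additivity and semilinearity of the Cartier relation\<close>

context
  fixes x :: "'r::idom" and p :: nat
  assumes char: "CHAR('r) = p" "p > 0"
begin

interpretation kaehler: module "kscale :: 'r \<Rightarrow> 'r kaehler \<Rightarrow> 'r kaehler"
  by (rule module_kscale)

lemma cartier_rel_zero: "cartier_rel p x 0 0"
  unfolding cartier_rel_def using char(2) by (intro exI[of _ "\<lambda>_. 0"]) (simp add: zero_power kaehler.scale_zero_left)

lemma cartier_rel_add:
  assumes "cartier_rel p x \<omega> \<eta>" "cartier_rel p x \<omega>' \<eta>'"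
  shows "cartier_rel p x (\<omega> + \<omega>') (\<eta> + \<eta>')"
proof -
  have prime: "prime CHAR('r)" using char prime_CHAR_semidom[where 'a = 'r] by simp
  obtain z w where
    z: "\<omega> = kscale (\<Sum>i<p. z i ^ p * x ^ i) (kd x)" "\<eta> = kscale (z (p - 1)) (kd x)" and
    w: "\<omega>' = kscale (\<Sum>i<p. w i ^ p * x ^ i) (kd x)" "\<eta>' = kscale (w (p - 1)) (kd x)"
    using assms unfolding cartier_rel_def by (elim exE conjE)
  show ?thesis
    unfolding cartier_rel_def z w kaehler.scale_left_distrib[symmetric] sum.distrib[symmetric]
    by (intro exI[of _ "\<lambda>i. z i + w i"])
      (simp only: freshmans_dream[OF prime char(1)[symmetric]] distrib_right simp_thms)
qed

text \<open>The scalar is absorbed into the p-th powers, z_i becoming a z_i. This is the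
  p^(-1)-linearity of the Cartier operator.\<close>

lemma cartier_rel_scale:
  assumes "cartier_rel p x \<omega> \<eta>"
  shows "cartier_rel p x (kscale (a ^ p) \<omega>) (kscale a \<eta>)"
proof -
  obtain z where
    z: "\<omega> = kscale (\<Sum>i<p. z i ^ p * x ^ i) (kd x)" "\<eta> = kscale (z (p - 1)) (kd x)"
    using assms unfolding cartier_rel_def by (elim exE conjE)
  show ?thesis
    unfolding cartier_rel_def z kaehler.scale_scale sum_distrib_left
    by (intro exI[of _ "\<lambda>i. a * z i"]) (simp only: power_mult_distrib mult.assoc simp_thms)
qed

lemma cartier_rel_sum:
  assumes "\<And>q. q \<in> A \<Longrightarrow> cartier_rel p x (\<omega> q) (\<eta> q)"
  shows "cartier_rel p x (\<Sum>q\<in>A. \<omega> q) (\<Sum>q\<in>A. \<eta> q)"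
  using assms
  by (induction A rule: infinite_finite_induct) (simp_all add: cartier_rel_zero cartier_rel_add)

end

section \<open>The superelliptic function field\<close>

locale superelliptic =
  fixes f :: "'a::field poly"
    and \<pi> :: "'a poly fract poly \<Rightarrow> 'K::field"
    and p m :: nat
  assumes char: "CHAR('a) = p" "p > 0"
    and perfect: "surj (\<lambda>c::'a. c ^ p)"
    and m: "m > 0" "\<not> p dvd m"
    and f_nonzero: "f \<noteq> 0"
    and K: "superelliptic_function_field m f \<pi>"
begin

abbreviation relation :: "'a poly fract poly" where
  "relation \<equiv> monom 1 m - [:to_fract f:]"

abbreviation emb :: "'a poly \<Rightarrow> 'K" where
  "emb g \<equiv> \<pi> [:to_fract g:]"

abbreviation const :: "'a \<Rightarrow> 'K" where
  "const \<equiv> const_of \<pi>"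

abbreviation x :: 'K where
  "x \<equiv> gen_x \<pi>"

abbreviation y :: 'K where
  "y \<equiv> gen_y \<pi>"

section \<open>The embedding of k[x] into K and the generators of K\<close>

lemma quotient_map: "quotient_map \<pi> relation"
  using K by (simp add: superelliptic_function_field_def)

lemma \<pi>_1: "\<pi> 1 = 1"
  and \<pi>_add: "\<pi> (a + b) = \<pi> a + \<pi> b"
  and \<pi>_mult: "\<pi> (a * b) = \<pi> a * \<pi> b"
  and \<pi>_eq_0_iff: "\<pi> a = 0 \<longleftrightarrow> relation dvd a"
  using quotient_map unfolding quotient_map_def by blast+

lemma \<pi>_0: "\<pi> 0 = 0"
  by (simp add: \<pi>_eq_0_iff)

lemma \<pi>_diff: "\<pi> (a - b) = \<pi> a - \<pi> b"
  using \<pi>_add[of "a - b" b] by simp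

lemma \<pi>_power: "\<pi> (a ^ n) = \<pi> a ^ n"
  by (induction n) (simp_all add: \<pi>_1 \<pi>_mult)

lemma emb_0: "emb 0 = 0"
  by (simp add: \<pi>_0)

lemma emb_1: "emb 1 = 1"
  by (simp add: \<pi>_1 flip: one_pCons)

lemma emb_add: "emb (g + h) = emb g + emb h"
  by (simp flip: \<pi>_add)

lemma emb_mult: "emb (g * h) = emb g * emb h"
proof -
  have "[:to_fract (g * h):] = [:to_fract g:] * [:to_fract h:]" by simp
  thus ?thesis by (simp only: \<pi>_mult)
qed

lemma emb_power: "emb (g ^ n) = emb g ^ n"
  by (induction n) (simp_all only: power_0 power_Suc emb_1 emb_mult)

lemma emb_sum: "emb (\<Sum>i\<in>A. g i) = (\<Sum>i\<in>A. emb (g i))"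
  by (induction A rule: infinite_finite_induct)
    (simp_all only: sum.infinite sum.empty sum.insert emb_0 emb_add not_False_eq_True)

text \<open>The relation has positive degree \<open>m\<close> in the indeterminate, so it divides no
  nonzero constant polynomial.\<close>

lemma emb_eq_0_iff: "emb g = 0 \<longleftrightarrow> g = 0"
proof
  assume "emb g = 0"
  hence "relation dvd [:to_fract g:]" by (simp only: \<pi>_eq_0_iff)
  moreover have "degree relation = m"
    using m(1) degree_add_eq_left[of "- [:to_fract f:]" "monom 1 m"]
    unfolding add_uminus_conv_diff by (simp add: degree_monom_eq)
  ultimately have "[:to_fract g:] = 0"
    using m(1) dvd_imp_degree_le[of relation "[:to_fract g:]"] by force
  thus "g = 0" by simp
qed (simp only: emb_0)

lemma emb_of_nat: "emb (of_nat n) = of_nat n"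
  by (induction n) (simp_all only: of_nat_0 of_nat_Suc emb_0 emb_1 emb_add)

lemma CHAR_K: "CHAR('K) = p"
proof -
  have "of_nat n = (0 :: 'K) \<longleftrightarrow> p dvd n" for n
    unfolding emb_of_nat[symmetric] emb_eq_0_iff of_nat_eq_0_iff_char_dvd using char(1) by simp
  thus ?thesis by (intro CHAR_eqI) simp_all
qed

lemma prime: "prime p"
  using char prime_CHAR_semidom[where 'a = 'a] by simp

lemma of_nat_m_nonzero: "of_nat m \<noteq> (0 :: 'K)"
  using m(2) by (simp add: of_nat_eq_0_iff_char_dvd CHAR_K)

lemma y_power_m: "y ^ m = emb f"
proof -
  have "\<pi> (monom 1 m) - emb f = 0"
    unfolding \<pi>_diff[symmetric] \<pi>_eq_0_iff by simp
  thus ?thesis by (simp add: gen_y_def monom_altdef \<pi>_power)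
qed

lemma y_nonzero: "y \<noteq> 0"
  using y_power_m f_nonzero m(1) emb_eq_0_iff[of f] by (metis zero_power)

lemma const_add: "const (a + b) = const a + const b"
  unfolding const_of_def by (simp flip: emb_add)

lemma const_mult: "const (a * b) = const a * const b"
proof -
  have "[:a * b:] = [:a:] * [:b:]" by simp
  thus ?thesis by (simp only: const_of_def emb_mult)
qed

lemma const_0: "const 0 = 0"
  by (simp add: const_of_def \<pi>_0)

lemma const_1: "const 1 = 1"
  using emb_1 by (simp add: const_of_def one_pCons)

lemma const_power: "const (a ^ n) = const a ^ n"
  by (induction n) (simp_all add: const_mult const_1)

lemma emb_monom: "emb (monom c n) = const c * x ^ n"
proof -
  have "monom c n = [:c:] * [:0, 1:] ^ n" by (simp add: monom_altdef)
  thus ?thesis by (simp only: emb_mult emb_power const_of_def gen_x_def)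
qed

lemma emb_eq_sum:
  assumes "degree g < n"
  shows "emb g = (\<Sum>i<n. const (coeff g i) * x ^ i)"
proof -
  have "(\<Sum>i\<le>n - 1. monom (coeff g i) i) = g"
    using assms by (intro poly_as_sum_of_monoms') simp
  moreover have "{..n - 1} = {..<n}" using assms by auto
  ultimately have "emb g = emb (\<Sum>i<n. monom (coeff g i) i)" by simp
  thus ?thesis by (simp only: emb_sum emb_monom)
qed

text \<open>Implicit differentiation of \<open>y^m = f\<close> gives the value \<open>y f' / (m f)\<close> at \<open>y\<close>.\<close>

lemma derivation_exists:
  obtains D :: "'K \<Rightarrow> 'K" where "derivation D" "D x = 1"
proof -
  have "derivation (pderiv :: 'a poly \<Rightarrow> 'a poly)"
    by standard (simp_all add: pderiv_add pderiv_mult)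
  then obtain E where E: "derivation E" "\<And>a::'a poly. E (to_fract a) = to_fract (pderiv a)"
    by (rule derivation_extends_to_fract) (rule that)
  interpret E: derivation E by (fact E(1))
  define F where "F = to_fract f"
  define u where "u = smult (E F / (of_nat m * F)) [:0, 1:]"
  define \<delta> where "\<delta> g = map_poly E g + u * pderiv g" for g
  have of_nat_to_fract: "of_nat n = to_fract (of_nat n :: 'a poly)" for n
    by (induction n) simp_all
  have m_nz: "of_nat m \<noteq> (0 :: 'a poly fract)"
    unfolding of_nat_to_fract to_fract_eq_0_iff of_nat_eq_0_iff_char_dvd using m(2) char(1) by simp
  have F_nz: "F \<noteq> 0" using f_nonzero by (simp add: F_def)
  have "map_poly E relation = - [:E F:]"
    using m(1) by (intro poly_eqI) (auto simp: coeff_map_poly F_def E.diff coeff_pCons split: nat.split)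
  moreover have "u * pderiv relation = monom (E F / F) m"
  proof -
    have "pCons 0 (monom c (m - Suc 0)) = monom c m" for c :: "'a poly fract"
      using m(1) by (cases m) (simp_all add: monom_Suc)
    thus ?thesis
      using m_nz by (simp add: u_def pderiv_diff pderiv_monom smult_monom)
  qed
  \<comment> \<open>With F' = \<open>E F\<close>, one has -F' + (F'/F) y^m = (F'/F) (y^m - F): the
    choice of \<open>u\<close> makes the ideal stable under \<open>\<delta>\<close>.\<close>
  ultimately have "\<delta> relation = smult (E F / F) relation"
    using F_nz by (simp add: \<delta>_def smult_diff_right smult_monom F_def)
  hence dvd: "relation dvd \<delta> relation" by (simp add: dvd_smult)
  have \<delta>: "derivation \<delta>"
    unfolding \<delta>_def by (rule derivation_extends_to_poly) (fact E(1))
  obtain D where D: "derivation D" "\<And>a. D (\<pi> a) = \<pi> (\<delta> a)"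
    by (rule derivation_descends_to_quotient[OF \<delta> quotient_map dvd]) (rule that)
  have "\<delta> [:to_fract [:0, 1:]:] = [:to_fract [:1:]:]"
    by (simp add: \<delta>_def map_poly_pCons E(2) pderiv_pCons)
  hence "\<delta> [:to_fract [:0, 1:]:] = 1"
    by (simp only: one_pCons[symmetric] to_fract_1)
  hence "D x = 1" by (simp add: gen_x_def D(2) \<pi>_1)
  with D(1) show ?thesis by (rule that)
qed

lemma cartier_eq:
  assumes "cartier_rel p x \<omega> \<eta>"
  shows "cartier p x \<omega> = \<eta>"
proof -
  obtain D :: "'K \<Rightarrow> 'K" where "derivation D" "D x = 1"
    by (rule derivation_exists)
  thus ?thesis using CHAR_K char(2) assms by (rule cartier_eqI)
qed

section \<open>Roots of constants and polynomial differentials\<close>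

lemma frobenius_root_power: "frobenius_root p c ^ p = c" for c :: 'a
  unfolding frobenius_root_def using surj_f_inv_f[OF perfect] .

lemma const_frobenius_root_power: "const (frobenius_root p c) ^ p = const c"
  by (simp flip: const_power add: frobenius_root_power)

lemma frobenius_root_0: "frobenius_root p (0 :: 'a) = 0"
  using frobenius_root_power[of 0] by simp

sublocale kaehler: module "kscale :: 'K \<Rightarrow> 'K kaehler \<Rightarrow> 'K kaehler"
  by (rule module_kscale)

sublocale kaehler_const: module "\<lambda>c. kscale (const c) :: 'K kaehler \<Rightarrow> 'K kaehler"
  by standard (simp_all add: const_add const_mult const_1 kaehler.scale_left_distrib
      kaehler.scale_right_distrib)

text \<open>The exponents are grouped into \<open>N\<close> blocks of length \<open>p\<close>.
  Constants are p-th powers, so block \<open>q\<close> already has the required shape, and its last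
  exponent \<open>q * p + (p - 1)\<close> supplies the Cartier image.\<close>

lemma cartier_rel_emb:
  assumes "degree g < N * p"
  shows "cartier_rel p x (kscale (emb g) (kd x))
    (\<Sum>q<N. kscale (const (frobenius_root p (coeff g (q * p + (p - 1)))) * x ^ q) (kd x))"
proof -
  have "emb g = (\<Sum>q<N. \<Sum>i = q * p..<q * p + p. const (coeff g i) * x ^ i)"
    unfolding emb_eq_sum[OF assms] by (rule sum.nat_group[symmetric])
  also have "\<dots> = (\<Sum>q<N. \<Sum>r<p. const (coeff g (q * p + r)) * x ^ (q * p + r))"
    by (simp add: sum.atLeastLessThan_shift_0[of _ "_ * p"] atLeast0LessThan add.commute)
  also have "kscale \<dots> (kd x) =
      (\<Sum>q<N. kscale (\<Sum>r<p. const (coeff g (q * p + r)) * x ^ (q * p + r)) (kd x))"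
    by (rule kaehler.scale_sum_left)
  finally show ?thesis
  proof (elim ssubst, intro cartier_rel_sum[OF CHAR_K char(2)])
    fix q
    have "const (coeff g (q * p + r)) * x ^ (q * p + r) =
        (const (frobenius_root p (coeff g (q * p + r))) * x ^ q) ^ p * x ^ r" for r
      by (simp add: power_mult_distrib const_frobenius_root_power power_add power_mult)
    thus "cartier_rel p x
        (kscale (\<Sum>r<p. const (coeff g (q * p + r)) * x ^ (q * p + r)) (kd x))
        (kscale (const (frobenius_root p (coeff g (q * p + (p - 1)))) * x ^ q) (kd x))"
      unfolding cartier_rel_def
      by (intro exI[of _ "\<lambda>r. const (frobenius_root p (coeff g (q * p + r))) * x ^ q"]) simp
  qed
qed

section \<open>The differentials \<open>omega\<close> and their Cartier images\<close>

text \<open>Frobenius fixes the prime field, which allows the factor 1/m of \<open>omega\<close> to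
  be moved inside a p-th power.\<close>

lemma of_nat_power_p: "of_nat n ^ p = (of_nat n :: 'K)"
proof (induction n)
  case 0
  show ?case using char(2) by simp
next
  case (Suc n)
  have "(1 + of_nat n) ^ p = 1 ^ p + (of_nat n :: 'K) ^ p"
    by (rule freshmans_dream) (simp_all only: CHAR_K prime)
  thus ?case by (simp only: Suc.IH of_nat_Suc power_one)
qed

lemma omega_eq:
  assumes "1 \<le> l" "j * p = m * t + l" "t + n + 1 = p"
  shows "omega m \<pi> k l =
    kscale ((y ^ j / (of_nat m * emb f)) ^ p) (kscale (emb (monom 1 (k - 1) * f ^ n)) (kd x))"
proof -
  \<comment> \<open>The exponents of y^(l - m) = y^(jp) y^(mn) / y^(mp), rearranged so that none is
    negative.\<close>
  have "l - 1 + m * p = m - 1 + (j * p + m * n)"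
    using assms(1,2) m(1) by (simp add: assms(3)[symmetric] algebra_simps)
  hence "y ^ (l - 1) * (y ^ m) ^ p = y ^ (m - 1) * ((y ^ j) ^ p * (y ^ m) ^ n)"
    by (simp flip: power_mult power_add)
  hence eq: "y ^ (l - 1) / y ^ (m - 1) = (y ^ j) ^ p * emb f ^ n / emb f ^ p"
    using y_nonzero by (simp add: y_power_m[symmetric] frac_eq_eq mult.commute)
  have "x ^ (k - 1) * y ^ (l - 1) / (of_nat m * y ^ (m - 1)) =
      y ^ (l - 1) / y ^ (m - 1) * (x ^ (k - 1) / of_nat m)"
    by (simp add: mult_ac)
  also have "\<dots> = (y ^ j / (of_nat m * emb f)) ^ p * emb (monom 1 (k - 1) * f ^ n)"
    unfolding eq emb_mult emb_monom emb_power const_1 power_divide power_mult_distrib of_nat_power_p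
    by (simp add: mult_ac)
  finally show ?thesis unfolding omega_def kaehler.scale_scale by (simp only:)
qed

text \<open>Since y^j / y^m = y^(j - 1) / y^(m - 1), the root of the p-th power split off in
  \<open>omega_eq\<close> turns x^q dx back into a differential of the family
  \<open>j\<close>.\<close>

lemma omega_Suc:
  assumes "1 \<le> j"
  shows "kscale (y ^ j / (of_nat m * emb f)) (kscale (c * x ^ q) (kd x)) =
    kscale c (omega m \<pi> (Suc q) j)"
proof -
  have eq: "y ^ j / y ^ m = y ^ (j - 1) / y ^ (m - 1)"
    using assms m(1) y_nonzero by (cases j; cases m) simp_all
  have "y ^ j / (of_nat m * emb f) * (c * x ^ q) = y ^ j / y ^ m * (c * x ^ q / of_nat m)"
    by (simp add: y_power_m)
  also have "\<dots> = c * (x ^ q * y ^ (j - 1) / (of_nat m * y ^ (m - 1)))"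
    unfolding eq by (simp add: mult_ac)
  finally show ?thesis
    unfolding omega_def kaehler.scale_scale by (simp only: diff_Suc_1)
qed

text \<open>Combines \<open>omega_eq\<close>, \<open>cartier_rel_emb\<close> and
  \<open>omega_Suc\<close>. The relational form allows linear combinations to be taken
  afterwards.\<close>

lemma cartier_rel_omega:
  assumes j: "1 \<le> j" "j < m" and l: "1 \<le> l" "l < m" and jl: "[l = j * p] (mod m)"
    and k: "1 \<le> k" "k \<le> dj m (degree f) l"
  shows "cartier_rel p x (omega m \<pi> k l) (\<Sum>i = 1..dj m (degree f) j.
    kscale (const (B_matrix p m f j l i k)) (omega m \<pi> i j))"
proof -
  define d where "d = degree f"
  define t where "t = j * p div m"
  define n where "n = nj p m j"
  define N where "N = dj m d j"
  define g where "g = monom 1 (k - 1) * f ^ n"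
  have "l = j * p mod m" using jl l(2) by (simp add: cong_def)
  hence jp: "j * p = m * t + l" by (simp add: t_def)
  \<comment> \<open>This gives t < p, so the truncated subtraction in \<open>nj\<close> is
    exact.\<close>
  have "m * t < m * p" using jp j l(1) char(2) mult_strict_right_mono[of j m p] by linarith
  hence n: "t + n + 1 = p" by (simp add: n_def nj_def t_def[symmetric])
  \<comment> \<open>The degree k - 1 + n d of \<open>g\<close> stays below (N + 1) p - 1, the
    exponent belonging to i = d_j + 1. Multiplying by \<open>m\<close> replaces the floors
    \<open>a\<close> and \<open>e\<close> by the inequalities they satisfy.\<close>
  have bound: "k + n * d < p * (N + 1)"
  proof -
    define a where "a = d * j div m"
    define e where "e = d * l div m"
    have a: "m * a \<le> d * j" by (simp add: a_def)
    have e: "d * l < m * (e + 1)"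
      using m(1) dividend_less_times_div[of m "d * l"] by (simp add: e_def)
    \<comment> \<open>As k >= 1, the bound on \<open>k\<close> makes d_l positive, so the
      subtractions in \<open>dj\<close> are exact.\<close>
    have ke: "k + e + 1 \<le> d" using k by (simp add: dj_def d_def[symmetric] e_def)
    have "d * j < d * m" using j ke by simp
    hence "m * a < m * d" using a by (simp only: mult.commute[of d m])
    hence N: "N + 1 + a = d" by (simp add: N_def dj_def a_def[symmetric])
    have "m * (k + p * a) = m * k + p * (m * a)" by (simp add: algebra_simps)
    also have "\<dots> \<le> m * k + p * (d * j)" using a by simp
    also have "p * (d * j) = d * (j * p)" by simp
    also have "d * (j * p) = d * (m * t) + d * l" by (simp add: jp algebra_simps)
    also have "m * k + (d * (m * t) + d * l) < m * k + (d * (m * t) + m * (e + 1))" using e by simp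
    also have "\<dots> = m * (k + e + 1 + d * t)" by (simp add: algebra_simps)
    also have "\<dots> \<le> m * (d + d * t)" using ke by (intro mult_le_mono2) simp
    finally have "k + p * a < d + d * t" by (simp only: nat_mult_less_cancel_disj)
    moreover have "p * (N + 1) + p * a = d + d * t + n * d"
      by (simp only: distrib_left[symmetric] N) (simp add: n[symmetric] algebra_simps)
    ultimately show ?thesis by linarith
  qed
  have "degree g \<le> degree (monom (1 :: 'a) (k - 1)) + degree (f ^ n)"
    unfolding g_def by (rule degree_mult_le)
  also have "\<dots> \<le> k - 1 + n * d"
    by (simp add: degree_monom_eq degree_power_eq f_nonzero d_def)
  finally have deg: "degree g < N * p + (p - 1)" using bound k(1) char(2) by (simp add: algebra_simps)
  define B where "B q = frobenius_root p (coeff g (q * p + (p - 1)))" for q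
  have B: "B q = B_matrix p m f j l (Suc q) k" for q
  proof -
    \<comment> \<open>The quotient is the natural number \<open>t\<close>, which selects the first
      branch of \<open>b_entry\<close>.\<close>
    have "(of_int (int j * int p - int l) / of_nat m :: rat) = of_nat t"
    proof -
      have "int j * int p - int l = int m * int t" by (simp flip: of_nat_mult add: jp)
      thus ?thesis using m(1) by simp
    qed
    moreover have "coeff g (q * p + (p - 1)) = coeff_int (f ^ n) (int (Suc q) * int p - int k)"
    proof -
      \<comment> \<open>Here A = i p with i = q + 1. Removing x^(k - 1) from x^(ip - 1) leaves x^(ip
        - k), and both sides are zero when ip < k.\<close>
      define A where "A = q * p + p"
      have "q * p + (p - 1) - (k - 1) = A - k" "q * p + (p - 1) < k - 1 \<longleftrightarrow> A < k"
        using k(1) char(2) by (auto simp: A_def)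
      moreover have "int (Suc q) * int p - int k = int A - int k"
        by (simp add: A_def algebra_simps)
      moreover have "int A - int k < 0 \<longleftrightarrow> A < k" "nat (int A - int k) = A - k"
        by linarith+
      ultimately show ?thesis
        unfolding g_def coeff_monom_mult coeff_int_def by (simp only: mult_1)
    qed
    ultimately show ?thesis
      by (simp add: B_def B_matrix_def b_entry_def n_def)
  qed
  \<comment> \<open>\<open>Suc N\<close> blocks are taken because \<open>g\<close> may reach into
    block \<open>N\<close>. Its last exponent exceeds the degree of \<open>g\<close>, so that
    summand vanishes below.\<close>
  have "cartier_rel p x (omega m \<pi> k l) (kscale (y ^ j / (of_nat m * emb f))
      (\<Sum>q<Suc N. kscale (const (B q) * x ^ q) (kd x)))"
    unfolding omega_eq[OF l(1) jp n] g_def[symmetric] B_def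
    using deg by (intro cartier_rel_scale cartier_rel_emb CHAR_K char(2)) simp
  also have "kscale (y ^ j / (of_nat m * emb f)) (\<Sum>q<Suc N. kscale (const (B q) * x ^ q) (kd x)) =
      (\<Sum>q<Suc N. kscale (const (B q)) (omega m \<pi> (Suc q) j))"
    by (simp only: kaehler.scale_sum_right omega_Suc[OF j(1)])
  also have "\<dots> = (\<Sum>q<N. kscale (const (B q)) (omega m \<pi> (Suc q) j))"
    using deg by (simp add: B_def coeff_eq_0 frobenius_root_0 const_0)
  also have "\<dots> = (\<Sum>i = 1..N. kscale (const (B_matrix p m f j l i k)) (omega m \<pi> i j))"
    by (simp only: B One_nat_def sum.atLeast1_atMost_eq)
  finally show ?thesis by (simp only: N_def d_def)
qed

text \<open>The generators suffice: the relation is additive, and a constant scalar, being a p-th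
  power, passes through as its root. \<open>cartier_eq\<close> returns to the operator at the
  end.\<close>

lemma cartier_omega_span:
  assumes "1 \<le> j" "j < m" "1 \<le> l" "l < m" "[l = j * p] (mod m)"
  shows "cartier p x ` omega_span m (degree f) \<pi> l \<subseteq> omega_span m (degree f) \<pi> j"
proof (rule image_subsetI)
  fix \<omega> assume "\<omega> \<in> omega_span m (degree f) \<pi> l"
  hence "\<exists>\<eta> \<in> omega_span m (degree f) \<pi> j. cartier_rel p x \<omega> \<eta>"
    unfolding omega_span_def
  proof (induction rule: kaehler_const.span_induct_alt)
    case base
    show ?case
      using kaehler_const.span_zero cartier_rel_zero[OF CHAR_K char(2)] by blast
  next
    case (step c \<omega>k \<omega>)
    let ?S = "kaehler_const.span {omega m \<pi> i j | i. 1 \<le> i \<and> i \<le> dj m (degree f) j}"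
    from step.hyps obtain k where k: "1 \<le> k" "k \<le> dj m (degree f) l" "\<omega>k = omega m \<pi> k l" by blast
    from step.IH obtain \<eta> where \<eta>: "\<eta> \<in> ?S" "cartier_rel p x \<omega> \<eta>" by blast
    let ?\<theta> = "\<Sum>i = 1..dj m (degree f) j. kscale (const (B_matrix p m f j l i k)) (omega m \<pi> i j)"
    have "cartier_rel p x (kscale (const c) \<omega>k + \<omega>) (kscale (const (frobenius_root p c)) ?\<theta> + \<eta>)"
      using cartier_rel_omega[OF assms k(1,2)] \<eta>(2)
      unfolding const_frobenius_root_power[symmetric, of c] k(3)
      by (intro cartier_rel_add cartier_rel_scale CHAR_K char(2))
    moreover have "kscale (const (frobenius_root p c)) ?\<theta> + \<eta> \<in> ?S"
      by (intro kaehler_const.span_add[OF _ \<eta>(1)] kaehler_const.span_scale kaehler_const.span_sum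
        kaehler_const.span_base) auto
    ultimately show ?case by blast
  qed
  then obtain \<eta> where "\<eta> \<in> omega_span m (degree f) \<pi> j" "cartier_rel p x \<omega> \<eta>" by blast
  thus "cartier p x \<omega> \<in> omega_span m (degree f) \<pi> j" by (simp only: cartier_eq)
qed

end

theorem theorem3:
  fixes f :: "'a::field poly"
    and \<pi> :: "'a poly fract poly \<Rightarrow> 'K::field"
    and p m d :: nat
  assumes char: "CHAR('a) = p" "p > 0"
    and perfect: "surj (\<lambda>c::'a. c ^ p)"
    and m: "m \<ge> 2" "\<not> p dvd m"
    and f: "squarefree f" "degree f = d" "d \<ge> 3"
    and K: "superelliptic_function_field m f \<pi>"
  shows "(\<forall>j l. 1 \<le> j \<and> j \<le> m1 m d \<and> 1 \<le> l \<and> l \<le> m1 m d \<and> [l = j * p] (mod m) \<longrightarrow>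
            cartier p (gen_x \<pi>) ` omega_span m d \<pi> l \<subseteq> omega_span m d \<pi> j \<and>
            (\<forall>k. 1 \<le> k \<and> k \<le> dj m d l \<longrightarrow>
               cartier p (gen_x \<pi>) (omega m \<pi> k l) =
                 (\<Sum>i = 1..dj m d j. kscale (const_of \<pi> (B_matrix p m f j l i k)) (omega m \<pi> i j)))) \<and>
         ([p = 1] (mod m) \<longrightarrow>
            (\<forall>j. 1 \<le> j \<and> j \<le> m1 m d \<longrightarrow>
               cartier p (gen_x \<pi>) ` omega_span m d \<pi> j \<subseteq> omega_span m d \<pi> j))"
proof -
  have "f \<noteq> 0" using f(1) by auto
  then interpret superelliptic f \<pi> p m
    using char perfect m K by unfold_locales auto
  have lt: "j < m" if "j \<le> m1 m d" for j using that m(1) by (simp add: m1_def)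
  have span: "cartier p (gen_x \<pi>) ` omega_span m d \<pi> l \<subseteq> omega_span m d \<pi> j"
    if "1 \<le> j" "j \<le> m1 m d" "1 \<le> l" "l \<le> m1 m d" "[l = j * p] (mod m)" for j l
    using cartier_omega_span[OF that(1) lt[OF that(2)] that(3) lt[OF that(4)] that(5)]
    unfolding f(2) .
  have entries: "cartier p (gen_x \<pi>) (omega m \<pi> k l) =
      (\<Sum>i = 1..dj m d j. kscale (const_of \<pi> (B_matrix p m f j l i k)) (omega m \<pi> i j))"
    if "1 \<le> j" "j \<le> m1 m d" "1 \<le> l" "l \<le> m1 m d" "[l = j * p] (mod m)" "1 \<le> k" "k \<le> dj m d l"
    for j l k
    using cartier_eq[OF cartier_rel_omega[OF that(1) lt[OF that(2)] that(3) lt[OF that(4)]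
        that(5,6), unfolded f(2), OF that(7)]] .
  \<comment> \<open>For p congruent to 1 the choice l = j is admissible, so the last claim is the
    diagonal case.\<close>
  have one: "[j = j * p] (mod m)" if "[p = 1] (mod m)" for j
    using cong_sym[OF cong_scalar_left[OF that, of j]] by simp
  show ?thesis
    by (intro conjI allI impI; (elim conjE)?) (rule span entries; (assumption | rule one, assumption))+
qed

end
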